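(* Let $n\ge 2$ be an integer with $r$ distinct prime factors. Then for each $1\le j\le 2^r$, $$\lambda_j(-\tilde Q_n)+\varphi(n)\le \lambda_j(L_Q)\le \lambda_j(-\tilde Q_n)+n.$$
   Context: For a real symmetric $m\times m$ matrix $X$, $\lambda_1(X)\ge\dots\ge\lambda_m(X)$ denote its eigenvalues in decreasing order, with multiplicity. $\varphi$ is Euler's totient function. Let $p_1<\dots<p_r$ be the distinct primes dividing $n$ and $n_0=p_1\cdots p_r$. The divisors of $n_0$ are ordered as $(d_1,\dots,d_{2^r})$ recursively: for $r=1$ the order is $(1,p_1)$, and for $r$ primes the first $2^{r-1}$ entries are those for the primes $p_1,\dots,p_{r-1}$, the remaining $2^{r-1}$ entries being obtained by multiplying each of these, in order, by $p_r$. In particular $d_1=1$, $d_{2^r}=n_0$. For a divisor $d$ of $n_0$, $[d]=\{a\in\{0,1,\dots,n-1\}:\gcd(a,n_0)=d\}$ (with $\gcd(0,n_0)=n_0$), and $a_i=|[d_{i+1}]|$ for $1\le i\le 2^r-1$. The generating graph $\mathcal{E}_n$ of $\mathbb{Z}_n=\{0,\dots,n-1\}$ is the simple graph on $\mathbb{Z}_n$ in which distinct $a,b$ are adjacent iff $\langle a,b\rangle=\mathbb{Z}_n$ (iff $\gcd(a,b,n)=1$). All vertices in a class $[d_i]$ have the same degree in $\mathcal{E}_n$, denoted $\deg(d_i)$. For $i\ne j$ define $\rho_{1,j}=\rho_{j,1}=\sqrt{\varphi(n)a_{j-1}}$ for $j\ge2$, and for $i,j\ge 2$, $\rho_{i,j}=\sqrt{a_{i-1}a_{j-1}}$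 if $\gcd(d_i,d_j)=1$, $\rho_{i,j}=0$ otherwise. $\tilde Q_n$ is the symmetric $2^r\times2^r$ matrix with diagonal $(\varphi(n),0,\dots,0)$ and off-diagonal entries $\rho_{i,j}$. $L_Q$ is the symmetric $2^r\times 2^r$ matrix with diagonal $(n-\varphi(n),\deg(d_2),\dots,\deg(d_{2^r-1}),\varphi(n))$ and off-diagonal entries $-\rho_{i,j}$; it is the symmetric matrix associated with the Laplacian of $\mathcal{E}_n$. *)

theory Defs
  imports
    "HOL-Number_Theory.Number_Theory"
    "HOL-Algebra.Elementary_Groups"
    "Jordan_Normal_Form.Char_Poly"
begin

(* The j-th entry (j = 1, ..., m) of the decreasing list of the real roots, with algebraic
   multiplicity, of the characteristic polynomial.  For a real symmetric m x m matrix this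
   polynomial splits over the reals, so the list has length m. *)
definition eigenvalue_desc :: "real mat \<Rightarrow> nat \<Rightarrow> real" where
  "eigenvalue_desc A j = rev (sorted_list_of_multiset (proots (char_poly A))) ! (j - 1)"

definition n0 :: "nat \<Rightarrow> nat" where
  "n0 n = \<Prod>(prime_factors n)"

(* Divisors of the product of a list of distinct primes: each further prime p appends a copy
   of the current list multiplied by p, so [p1] gives [1, p1] and [p1, p2] gives
   [1, p1, p2, p1 * p2]. *)
definition divisor_order :: "nat list \<Rightarrow> nat list" where
  "divisor_order ps = foldl (\<lambda>ds p. ds @ map (\<lambda>d. d * p) ds) [1] ps"

(* All families below are indexed from 1. *)
definition dvs :: "nat \<Rightarrow> nat \<Rightarrow> nat" where
  "dvs n i = divisor_order (sorted_list_of_set (prime_factors n)) ! (i - 1)"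

definition dclass :: "nat \<Rightarrow> nat \<Rightarrow> int set" where
  "dclass n d = {a \<in> carrier (integer_mod_group n). gcd a (int (n0 n)) = int d}"

definition class_size :: "nat \<Rightarrow> nat \<Rightarrow> nat" where
  "class_size n i = card (dclass n (dvs n (i + 1)))"

definition gen_adj :: "nat \<Rightarrow> int \<Rightarrow> int \<Rightarrow> bool" where
  "gen_adj n a b \<longleftrightarrow>
     a \<in> carrier (integer_mod_group n) \<and> b \<in> carrier (integer_mod_group n) \<and> a \<noteq> b \<and>
     generate (integer_mod_group n) {a, b} = carrier (integer_mod_group n)"

definition gen_degree :: "nat \<Rightarrow> int \<Rightarrow> nat" where
  "gen_degree n a = card {b. gen_adj n a b}"

(* Well defined on nonempty classes by class_degree_eq below. *)
definition class_degree :: "nat \<Rightarrow> nat \<Rightarrow> nat" where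
  "class_degree n d = (THE k. \<forall>a \<in> dclass n d. gen_degree n a = k)"

definition rho :: "nat \<Rightarrow> nat \<Rightarrow> nat \<Rightarrow> real" where
  "rho n i j =
     (if i = 1 then sqrt (real (totient n) * real (class_size n (j - 1)))
      else if j = 1 then sqrt (real (totient n) * real (class_size n (i - 1)))
      else if gcd (dvs n i) (dvs n j) = 1
        then sqrt (real (class_size n (i - 1)) * real (class_size n (j - 1)))
      else 0)"

(* Matrix positions are counted from 0, the indices of rho and dvs from 1. *)
definition Q_tilde :: "nat \<Rightarrow> real mat" where
  "Q_tilde n = (let m = 2 ^ card (prime_factors n) in
     mat m m (\<lambda>(i, j).
       if i = j then (if i = 0 then real (totient n) else 0)
       else rho n (i + 1) (j + 1)))"

definition L_Q :: "nat \<Rightarrow> real mat" where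
  "L_Q n = (let m = 2 ^ card (prime_factors n) in
     mat m m (\<lambda>(i, j).
       if i = j then
         (if i = 0 then real n - real (totient n)
          else if i = m - 1 then real (totient n)
          else real (class_degree n (dvs n (i + 1))))
       else - rho n (i + 1) (j + 1)))"

lemma generate_two_eq_carrier_iff:
  assumes n: "n \<ge> 2"
    and a: "a \<in> carrier (integer_mod_group n)" and b: "b \<in> carrier (integer_mod_group n)"
  shows "generate (integer_mod_group n) {a, b} = carrier (integer_mod_group n)
    \<longleftrightarrow> gcd (gcd a b) (int n) = 1"
proof
  let ?G = "integer_mod_group n" and ?g = "gcd (gcd a b) (int n)"
  assume gen: "generate ?G {a, b} = carrier ?G"
  have "?g dvd x" if "x \<in> generate ?G {a, b}" for x
    using that
  proof (induction rule: generate.induct)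
    case one then show ?case by simp
  next
    case (incl h) then show ?case by (auto intro: dvd_trans[OF gcd_dvd1])
  next
    case (inv h)
    then have "?g dvd h" by (auto intro: dvd_trans[OF gcd_dvd1])
    moreover have "h \<in> carrier ?G" using inv a b by auto
    ultimately show ?case by (simp add: dvd_mod)
  next
    case (eng h1 h2) then show ?case by (simp add: dvd_mod)
  qed
  moreover have "1 \<in> generate ?G {a, b}" using gen n by simp
  ultimately have "?g dvd 1" by blast
  then show "?g = 1" by simp
next
  let ?G = "integer_mod_group n"
  interpret group ?G by simp
  assume g: "gcd (gcd a b) (int n) = 1"
  have sub: "subgroup (generate ?G {a, b}) ?G"
    using a b by (intro generate_is_subgroup) auto
  obtain u v where uv: "u * a + v * b = gcd a b" using bezout_int by blast
  obtain s t where st: "s * gcd a b + t * int n = gcd (gcd a b) (int n)"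
    using bezout_int by blast
  have "x \<in> generate ?G {a, b}" if x: "x \<in> carrier ?G" for x
  proof -
    have "(x * s * u * a) mod int n \<in> generate ?G {a, b}"
      using subgroup_int_pow_closed[OF sub, of a "x * s * u"]
      by (simp add: int_pow_integer_mod_group generate.incl)
    moreover have "(x * s * v * b) mod int n \<in> generate ?G {a, b}"
      using subgroup_int_pow_closed[OF sub, of b "x * s * v"]
      by (simp add: int_pow_integer_mod_group generate.incl)
    ultimately have "(x * s * u * a + x * s * v * b) mod int n \<in> generate ?G {a, b}"
      using generate.eng[where G = ?G and H = "{a, b}"] mod_add_eq
      by (metis mult_integer_mod_group)
    moreover have "x * s * u * a + x * s * v * b = x - x * t * int n"
    proof -
      have "x * (s * (u * a + v * b) + t * int n) = x" using uv st g by simp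
      then show ?thesis by (simp add: algebra_simps)
    qed
    moreover have "(x - x * t * int n) mod int n = x"
      using x n by (simp add: carrier_integer_mod_group mod_diff_eq[symmetric])
    ultimately show ?thesis by simp
  qed
  then show "generate ?G {a, b} = carrier ?G"
    using generate_incl[of "{a, b}"] a b by auto
qed

lemma prime_dvd_n0_iff:
  assumes "n \<ge> 2" "prime (p :: nat)"
  shows "p dvd n0 n \<longleftrightarrow> p dvd n"
proof
  assume "p dvd n0 n"
  then obtain q where "q \<in> prime_factors n" "p dvd q"
    using assms by (auto simp: n0_def prime_dvd_prod_iff)
  then show "p dvd n" by (meson dvd_trans in_prime_factors_iff)
next
  assume "p dvd n"
  then have "p \<in> prime_factors n" using assms by (auto simp: in_prime_factors_iff)
  then show "p dvd n0 n" unfolding n0_def by (intro dvd_prodI) auto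
qed

lemma coprime_n0_iff:
  fixes a :: int
  assumes n: "n \<ge> 2"
  shows "coprime a (int (n0 n)) \<longleftrightarrow> coprime a (int n)"
proof -
  have not_coprime: "\<not> coprime x y \<longleftrightarrow> (\<exists>p. prime p \<and> p dvd x \<and> p dvd y)" for x y :: nat
  proof
    assume "\<not> coprime x y"
    then have "gcd x y \<noteq> 1" using coprime_iff_gcd_eq_1[of x y] by blast
    then obtain p where "prime p" "p dvd gcd x y" using prime_factor_nat by blast
    then show "\<exists>p. prime p \<and> p dvd x \<and> p dvd y" by auto
  next
    assume "\<exists>p. prime p \<and> p dvd x \<and> p dvd y"
    then show "\<not> coprime x y"
      using coprime_common_divisor not_prime_unit by blast
  qed
  have "coprime x (n0 n) \<longleftrightarrow> coprime x n" for x
    using not_coprime[of x "n0 n"] not_coprime[of x n] prime_dvd_n0_iff[OF n] by blast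
  then have "coprime (int (nat \<bar>a\<bar>)) (int (n0 n)) \<longleftrightarrow> coprime (int (nat \<bar>a\<bar>)) (int n)"
    by (simp only: coprime_int_iff)
  then show ?thesis by simp
qed

lemma gen_adj_iff:
  assumes "n \<ge> 2"
  shows "gen_adj n a b \<longleftrightarrow>
    a \<in> {0..<int n} \<and> b \<in> {0..<int n} \<and> a \<noteq> b \<and> gcd (gcd a b) (int n) = 1"
  using generate_two_eq_carrier_iff[OF assms, of a b] assms
  by (auto simp: gen_adj_def carrier_integer_mod_group)

lemma gen_degree_dclass:
  assumes n: "n \<ge> 2" and a: "a \<in> dclass n d"
  shows "gen_degree n a = card {b \<in> {0..<int n}. coprime b (int d)} - (if d = 1 then 1 else 0)"
proof -
  have a0: "a \<in> {0..<int n}" and d: "gcd a (int (n0 n)) = int d"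
    using a n by (auto simp: dclass_def carrier_integer_mod_group)
  have key: "gcd (gcd a b) (int n) = 1 \<longleftrightarrow> coprime b (int d)" for b
  proof -
    have "gcd (gcd a b) (int n) = 1 \<longleftrightarrow> gcd (gcd a b) (int (n0 n)) = 1"
      using coprime_n0_iff[OF n, of "gcd a b"] by (simp only: coprime_iff_gcd_eq_1)
    also have "gcd (gcd a b) (int (n0 n)) = gcd b (gcd a (int (n0 n)))"
      by (simp only: ac_simps)
    finally show ?thesis using d by (simp only: coprime_iff_gcd_eq_1)
  qed
  have "{b. gen_adj n a b} = {b \<in> {0..<int n}. coprime b (int d)} - {a}"
    using a0 by (auto simp: gen_adj_iff[OF n] key)
  moreover have "coprime a (int d) \<longleftrightarrow> d = 1"
  proof -
    have "int d dvd a" using d by (metis gcd_dvd1)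
    then have "gcd a (int d) = int d" by simp
    then show ?thesis by (simp only: coprime_iff_gcd_eq_1 of_nat_eq_1_iff)
  qed
  ultimately show ?thesis using a0 by (auto simp: gen_degree_def)
qed

lemma class_degree_eq:
  assumes n: "n \<ge> 2" and a: "a \<in> dclass n d"
  shows "class_degree n d = gen_degree n a"
  unfolding class_degree_def using a gen_degree_dclass[OF n] by (intro the_equality) auto

end

(* L_Q + Q_tilde is diagonal with entries n, the degrees of the proper nontrivial classes, and
   totient n.  A nonunit is adjacent to every unit, so all these entries lie between totient n
   and n.  Hence the quadratic form of L_Q exceeds that of - Q_tilde by at least totient n and at
   most n on unit vectors, and Weyl's monotonicity principle transfers this to the ordered
   eigenvalues. *)

theory Submission
  imports Defs
begin

section \<open>Spectral theorem for real symmetric matrices\<close>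

text \<open>Over the complex numbers the polynomial splits. An eigenvector \<open>v\<close> for a
  root \<open>c\<close> gives \<open>v* A v = c |v|^2\<close>, and symmetry makes the left side
  real, so every root is real.\<close>

lemma symmetric_char_poly_splits:
  fixes A :: "real mat"
  assumes A: "A \<in> carrier_mat n n" and sym: "transpose_mat A = A"
  shows "\<exists>es. char_poly A = (\<Prod>e\<leftarrow>es. [:- e, 1:])"
proof -
  interpret of_real_poly: map_poly_inj_comm_ring_hom "of_real :: real \<Rightarrow> complex" ..
  let ?C = "map_mat complex_of_real A"
  have C: "?C \<in> carrier_mat n n" using A by simp
  obtain cs where cs: "char_poly ?C = (\<Prod>c\<leftarrow>cs. [:- c, 1:])"
    using char_poly_factorized[OF C] by blast
  have Aij: "A $$ (i, j) = A $$ (j, i)" if "i < n" "j < n" for i j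
    using that A sym by (metis carrier_matD index_transpose_mat(1))
  have "c \<in> \<real>" if "c \<in> set cs" for c
  proof -
    have "poly (char_poly ?C) c = 0"
      using that unfolding cs by (induction cs) auto
    then obtain v where "eigenvector ?C v c"
      using eigenvalue_root_char_poly[OF C] by (auto simp: eigenvalue_def)
    then have v: "v \<in> carrier_vec n" "v \<noteq> 0\<^sub>v n" "?C *\<^sub>v v = c \<cdot>\<^sub>v v"
      using A by (auto simp: eigenvector_def)
    define S where "S = (\<Sum>i<n. \<Sum>j<n. cnj (v $ i) * of_real (A $$ (i, j)) * v $ j)"
    have row: "(\<Sum>j<n. of_real (A $$ (i, j)) * v $ j) = c * v $ i" if "i < n" for i
    proof -
      have "(?C *\<^sub>v v) $ i = (\<Sum>j<n. of_real (A $$ (i, j)) * v $ j)"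
        using that A v(1) by (simp add: scalar_prod_def lessThan_atLeast0)
      then show ?thesis using that v by simp
    qed
    have "S = (\<Sum>i<n. cnj (v $ i) * (\<Sum>j<n. of_real (A $$ (i, j)) * v $ j))"
      by (simp add: S_def sum_distrib_left mult.assoc)
    also have "\<dots> = (\<Sum>i<n. c * of_real ((cmod (v $ i))\<^sup>2))"
      by (intro sum.cong refl) (simp only: lessThan_iff row, simp add: complex_norm_square mult_ac del: of_real_power)
    finally have S: "S = c * of_real (\<Sum>i<n. (cmod (v $ i))\<^sup>2)"
      by (simp add: sum_distrib_left)
    \<comment> \<open>Conjugation followed by \<open>A $$ (i, j) = A $$ (j, i)\<close> only
      interchanges the two summation indices.\<close>
    have "cnj S = (\<Sum>i<n. \<Sum>j<n. cnj (v $ j) * of_real (A $$ (j, i)) * v $ i)"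
      by (auto simp: S_def Aij mult_ac intro!: sum.cong)
    also have "\<dots> = S" unfolding S_def by (rule sum.swap)
    finally have real: "S \<in> \<real>" by (simp add: Reals_cnj_iff)
    have "\<exists>i<n. v $ i \<noteq> 0" using v by (metis carrier_vecD eq_vecI index_zero_vec)
    then have "(\<Sum>i<n. (cmod (v $ i))\<^sup>2) > 0" by (auto intro!: sum_pos2)
    then have "complex_of_real (\<Sum>i<n. (cmod (v $ i))\<^sup>2) \<noteq> 0"
      by (simp only: of_real_eq_0_iff)
    then have "c = S / of_real (\<Sum>i<n. (cmod (v $ i))\<^sup>2)" unfolding S by (rule nonzero_mult_div_cancel_right[symmetric])
    then show "c \<in> \<real>" using real by (metis Reals_divide Reals_of_real)
  qed
  \<comment> \<open>With all roots real, the complex factorization is the image of a real one;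
    injectivity of the coefficient embedding then brings it back to \<open>A\<close>.\<close>
  then have "(\<Prod>c\<leftarrow>cs. [:- c, 1:]) = map_poly of_real (\<Prod>e\<leftarrow>map Re cs. [:- e, 1:])"
  proof (induction cs)
    case (Cons c cs)
    then have "[:- c, 1:] = map_poly of_real [:- Re c, 1:]" by (simp add: map_poly_pCons)
    moreover have "(\<Prod>c\<leftarrow>cs. [:- c, 1:]) = map_poly of_real (\<Prod>e\<leftarrow>map Re cs. [:- e, 1:])"
      using Cons by simp
    ultimately show ?case
      by (simp only: list.map prod_list.Cons of_real_poly.hom_mult)
  qed simp
  then have "map_poly complex_of_real (char_poly A) = map_poly of_real (\<Prod>e\<leftarrow>map Re cs. [:- e, 1:])"
    using cs of_real_hom.char_poly_hom[OF A, where ?'a = complex] by simp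
  then have "char_poly A = (\<Prod>e\<leftarrow>map Re cs. [:- e, 1:])"
    by (simp only: of_real_poly.eq_iff)
  then show ?thesis by blast
qed

text \<open>The Householder reflection \<open>W = I - 2 u u^T / (u . u)\<close> with
  \<open>u = v - e_0\<close> exchanges the two unit vectors \<open>v\<close> and \<open>e_0\<close>.
  Being symmetric and an involution, it is orthogonal.\<close>

lemma householder_to_unit_vec:
  fixes v :: "real vec"
  assumes v: "v \<in> carrier_vec n" "v \<bullet> v = 1" and n: "0 < n"
  obtains W where "W \<in> carrier_mat n n" "transpose_mat W = W" "W * W = 1\<^sub>m n"
    "W *\<^sub>v unit_vec n 0 = v" "W *\<^sub>v v = unit_vec n 0"
proof -
  define u where "u i = v $ i - (if i = 0 then 1 else 0)" for i
  define s where "s = (\<Sum>i<n. u i * u i)"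
  (* If v is already the unit vector, then s = 0, hence c = 0 and W is the identity. *)
  define c where "c = 2 / s"
  define W where "W = mat n n (\<lambda>(i, j). (if i = j then 1 else 0) - c * u i * u j)"
  have vv: "(\<Sum>i<n. v $ i * v $ i) = 1"
    using v by (simp add: scalar_prod_def lessThan_atLeast0)
  have W: "W \<in> carrier_mat n n" by (simp add: W_def)
  have sym: "transpose_mat W = W" by (rule eq_matI) (auto simp: W_def)
  have uv: "(\<Sum>i<n. u i * v $ i) = 1 - v $ 0"
    using n by (simp add: u_def left_diff_distrib sum_subtractf vv if_distrib[of "\<lambda>x. x * _"] sum.delta cong: if_cong)
  have "s = (\<Sum>i<n. u i * v $ i) - (\<Sum>i<n. u i * (if i = 0 then 1 else 0))"
    unfolding s_def sum_subtractf[symmetric]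
    by (intro sum.cong) (auto simp: u_def algebra_simps)
  also have "\<dots> = 2 - 2 * v $ 0"
  proof -
    have "(\<Sum>i<n. u i * (if i = 0 then 1 else 0)) = (\<Sum>i<n. if i = 0 then u i else 0)"
      by (intro sum.cong) auto
    then show ?thesis using n u_def[of 0] by (simp add: uv)
  qed
  finally have s: "s = 2 - 2 * v $ 0" .
  have u0: "u i = 0" if "s = 0" "i < n" for i
    using that by (auto simp: s_def sum_nonneg_eq_0_iff)
  \<comment> \<open>This is what cancels the rank-one terms in \<open>W * W\<close>.\<close>
  have cc: "c * c * s = 2 * c" by (simp add: c_def)
  have "(W * W) $$ (i, j) = 1\<^sub>m n $$ (i, j)" if ij: "i < n" "j < n" for i j
  proof -
    have "(W * W) $$ (i, j) = (\<Sum>k<n. ((if i = k then 1 else 0) - c * u i * u k) *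
        ((if k = j then 1 else 0) - c * u k * u j))"
      using ij by (simp add: W_def scalar_prod_def lessThan_atLeast0)
    also have "\<dots> = (\<Sum>k<n. (if i = k then (if k = j then 1 else 0) - c * u k * u j else 0)
        - (if k = j then c * u i * u k else 0) + c * c * u i * u j * (u k * u k))"
      by (intro sum.cong) (auto simp: algebra_simps)
    also have "\<dots> = (if i = j then 1 else 0) - 2 * c * u i * u j + c * c * u i * u j * s"
      using ij by (simp add: sum.distrib sum_subtractf sum.delta sum.delta' s_def sum_distrib_left)
    also have "\<dots> = (if i = j then 1 else 0)" 
    proof -
      have "c * c * u i * u j * s = (c * c * s) * (u i * u j)" by (simp add: mult_ac)
      then show ?thesis using cc by simp
    qed
    finally show ?thesis using ij by simp
  qed
  then have WW: "W * W = 1\<^sub>m n" using W by (intro eq_matI) auto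
  have "(W *\<^sub>v v) $ i = unit_vec n 0 $ i" if i: "i < n" for i
  proof -
    have "(W *\<^sub>v v) $ i = (\<Sum>k<n. ((if i = k then 1 else 0) - c * u i * u k) * v $ k)"
      using i v by (simp add: W_def scalar_prod_def lessThan_atLeast0)
    also have "\<dots> = (\<Sum>k<n. (if i = k then v $ k else 0) - c * u i * (u k * v $ k))"
      by (intro sum.cong) (auto simp: algebra_simps)
    also have "\<dots> = v $ i - c * u i * (1 - v $ 0)"
      using i by (simp add: sum_subtractf sum.delta uv flip: sum_distrib_left)
    also have "\<dots> = v $ i - u i"
    proof -
      have "1 - v $ 0 = s / 2" using s by simp
      then have "c * u i * (1 - v $ 0) = c * s * u i / 2" by simp
      also have "\<dots> = u i" using u0[OF _ i] by (cases "s = 0") (auto simp: c_def)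
      finally show ?thesis by simp
    qed
    finally show ?thesis using i n by (simp add: u_def unit_vec_def)
  qed
  then have Wv: "W *\<^sub>v v = unit_vec n 0" using W by (intro eq_vecI) auto
  then have "W *\<^sub>v unit_vec n 0 = v"
    using assoc_mult_mat_vec[OF W W v(1)] WW v(1) by simp
  then show thesis using that W sym WW Wv by blast
qed

text \<open>Induction on the list of roots: a reflection moves an eigenvector for the head
  \<open>e\<close> to \<open>e_0\<close>, which splits off a 1 x 1 block, and the remaining block
  has the tail as its roots. The diagonal follows the given order of \<open>es\<close>, so a
  decreasing list may be prescribed later.\<close>

lemma symmetric_diagonalization:
  fixes A :: "real mat"
  assumes "A \<in> carrier_mat n n" "transpose_mat A = A"
    "char_poly A = (\<Prod>e\<leftarrow>es. [:- e, 1:])"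
  shows "\<exists>Q\<in>carrier_mat n n. transpose_mat Q * Q = 1\<^sub>m n \<and>
    A = transpose_mat Q * mat_diag n ((!) es) * Q"
  using assms
proof (induction es arbitrary: n A)
  case Nil
  then have "n = 0" using degree_monic_char_poly[of A n] by simp
  then show ?case using Nil by (intro bexI[of _ "1\<^sub>m 0"]) (auto intro!: eq_matI)
next
  case (Cons e es n A)
  note A = Cons.prems(1) and sym = Cons.prems(2) and cp = Cons.prems(3)
  have "poly (char_poly A) e = 0" by (simp add: cp)
  then obtain w where "eigenvector A w e"
    using eigenvalue_root_char_poly[OF A] by (auto simp: eigenvalue_def)
  then have w: "w \<in> carrier_vec n" "w \<noteq> 0\<^sub>v n" "A *\<^sub>v w = e \<cdot>\<^sub>v w"
    using A by (auto simp: eigenvector_def)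
  have n: "0 < n" using w by (cases n) auto
  then obtain m where m: "n = Suc m" by (cases n) auto
  have ww: "w \<bullet> w > 0"
  proof -
    have "\<exists>i<n. w $ i \<noteq> 0" using w by (metis carrier_vecD eq_vecI index_zero_vec)
    then have "(\<Sum>i\<in>{0..<n}. w $ i * w $ i) > 0"
      by (auto intro!: sum_pos2 simp: zero_less_mult_iff)
    then show ?thesis using w(1) by (simp add: scalar_prod_def)
  qed
  define v where "v = (1 / sqrt (w \<bullet> w)) \<cdot>\<^sub>v w"
  have v: "v \<in> carrier_vec n" "v \<bullet> v = 1"
    using w ww by (simp_all add: v_def)
  have Av: "A *\<^sub>v v = e \<cdot>\<^sub>v v"
    using w A by (simp add: v_def mult_mat_vec smult_smult_assoc mult.commute)
  obtain W where W: "W \<in> carrier_mat n n" "transpose_mat W = W" "W * W = 1\<^sub>m n"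
    "W *\<^sub>v unit_vec n 0 = v" "W *\<^sub>v v = unit_vec n 0"
    using householder_to_unit_vec[OF v n] by blast
  define A' where "A' = W * A * W"
  have A': "A' \<in> carrier_mat n n" using W A by (simp add: A'_def)
  have sym': "transpose_mat A' = A'"
    using W A sym by (simp add: A'_def transpose_mult[of _ n n _ n])
  \<comment> \<open>\<open>W\<close> sends \<open>e_0\<close> to \<open>v\<close>, \<open>A\<close>
    scales \<open>v\<close> by \<open>e\<close>, and \<open>W\<close> sends it back. This fixes the
    first column of \<open>A'\<close>, and by symmetry its first row.\<close>
  have "A' *\<^sub>v unit_vec n 0 = e \<cdot>\<^sub>v unit_vec n 0"
    using W A v by (simp add: A'_def assoc_mult_mat_vec[of _ n n _ n] Av mult_mat_vec)
  then have "(A' *\<^sub>v unit_vec n 0) $ i = (e \<cdot>\<^sub>v unit_vec n 0) $ i" for i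
    by simp
  note A'0 = this
  have col0: "A' $$ (i, 0) = (if i = 0 then e else 0)" if "i < n" for i
    using A'0[of i] that A' n by (simp split: if_splits)
  have row0: "A' $$ (0, i) = (if i = 0 then e else 0)" if "i < n" for i
    using col0[OF that] that A' sym' n by (metis carrier_matD index_transpose_mat(1))
  define E where "E = mat 1 1 (\<lambda>_. e)"
  define A3 where "A3 = mat m m (\<lambda>(i, j). A' $$ (Suc i, Suc j))"
  have E: "E \<in> carrier_mat 1 1" and A3: "A3 \<in> carrier_mat m m"
    by (auto simp: E_def A3_def)
  have split: "A' = four_block_mat E (0\<^sub>m 1 m) (0\<^sub>m m 1) A3"
    using A' m by (intro eq_matI) (auto simp: E_def A3_def row0 col0)
  have sym3: "transpose_mat A3 = A3"
    using A' sym' by (intro eq_matI) (auto simp: A3_def m, metis A' Suc_less_eq carrier_matD index_transpose_mat(1) m)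
  \<comment> \<open>\<open>W\<close> is its own inverse, so the conjugation keeps the characteristic
    polynomial, and the factor of the block \<open>E\<close> can be cancelled.\<close>
  have "similar_mat_wit A' A W W"
    using W A A' by (intro similar_mat_witI[of _ _ n]) (auto simp: A'_def)
  then have "char_poly A' = char_poly A"
    by (intro char_poly_similar) (auto simp: similar_mat_def)
  moreover have "char_poly A' = char_poly E * char_poly A3"
    unfolding split by (rule char_poly_four_block_zeros_col[OF E _ A3]) simp
  moreover have "char_poly E = [:- e, 1:]"
    by (subst char_poly_upper_triangular[OF E]) (auto simp: E_def diag_mat_def)
  ultimately have "[:- e, 1:] * char_poly A3 = [:- e, 1:] * (\<Prod>e\<leftarrow>es. [:- e, 1:])"
    using cp by simp
  then have "char_poly A3 = (\<Prod>e\<leftarrow>es. [:- e, 1:])"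
    by (subst (asm) mult_cancel_left) auto
  from Cons.IH[OF A3 sym3 this] obtain P where P: "P \<in> carrier_mat m m"
    "transpose_mat P * P = 1\<^sub>m m" "A3 = transpose_mat P * mat_diag m ((!) es) * P" by blast
  \<comment> \<open>The orthogonal matrix of the smaller block, extended by a fixed first
    coordinate; \<open>R * W\<close> will diagonalize \<open>A\<close>.\<close>
  define R where "R = four_block_mat (1\<^sub>m 1) (0\<^sub>m 1 m) (0\<^sub>m m 1) P"
  define D where "D = mat_diag n ((!) (e # es))"
  have D: "D = four_block_mat E (0\<^sub>m 1 m) (0\<^sub>m m 1) (mat_diag m ((!) es))"
    unfolding D_def using m by (intro eq_matI) (auto simp: E_def mat_diag_def)
  have R: "R \<in> carrier_mat n n" and Dc: "D \<in> carrier_mat n n"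
    using P m by (auto simp: R_def D_def)
  have Rt: "transpose_mat R = four_block_mat (1\<^sub>m 1) (0\<^sub>m 1 m) (0\<^sub>m m 1) (transpose_mat P)"
    unfolding R_def using P by (subst transpose_four_block_mat[of _ 1 1 _ m _ m]) auto
  have RtR: "transpose_mat R * R = 1\<^sub>m n"
    unfolding Rt unfolding R_def using P m
    by (subst mult_four_block_mat[of _ 1 1 _ m _ m _ _ 1 _ m]) (auto intro!: eq_matI)
  have PD: "transpose_mat P * mat_diag m ((!) es) \<in> carrier_mat m m"
    using P by (auto intro: mult_carrier_mat)
  have "transpose_mat R * D * R = A'"
    unfolding Rt D split unfolding R_def using P E
    by (auto simp: mult_four_block_mat[of _ 1 1 _ m _ m _ _ 1 _ m] left_mult_zero_mat[of _ m m]
        right_mult_zero_mat[OF PD] left_add_zero_mat[OF mult_carrier_mat[OF PD]])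
  then have A'D: "A' = transpose_mat R * D * R" ..
  note assoc = assoc_mult_mat[of _ n n _ n _ n] and carr = mult_carrier_mat[of _ n n _ n]
  have tW: "transpose_mat (R * W) = W * transpose_mat R"
    using R W by (simp add: transpose_mult[of _ n n _ n])
  have WX: "W * (W * X) = X" if "X \<in> carrier_mat n n" for X
    using W that by (simp add: assoc_mult_mat[OF W(1) W(1) that, symmetric] del: assoc_mult_mat)
  have "A = W * A' * W"
    using W A unfolding A'_def by (simp add: WX)
  also have "\<dots> = transpose_mat (R * W) * D * (R * W)"
    unfolding A'D tW using R W Dc by (simp add: assoc carr del: assoc_mult_mat)
  finally have AD: "A = transpose_mat (R * W) * D * (R * W)" .
  have "transpose_mat (R * W) * (R * W) = W * (transpose_mat R * R) * W"
    unfolding tW using R W by (simp add: assoc carr del: assoc_mult_mat)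
  then have "transpose_mat (R * W) * (R * W) = 1\<^sub>m n" using W RtR by simp
  moreover have "R * W \<in> carrier_mat n n" by (rule mult_carrier_mat[OF R W(1)])
  ultimately show ?case using AD unfolding D_def by blast
qed

section \<open>Quadratic forms in eigenvector coordinates\<close>

lemma orthogonal_preserves_scalar_prod:
  fixes Q :: "real mat"
  assumes Q: "Q \<in> carrier_mat n n" "transpose_mat Q * Q = 1\<^sub>m n" and x: "x \<in> carrier_vec n"
  shows "x \<bullet> x = (\<Sum>i<n. ((Q *\<^sub>v x) $ i)\<^sup>2)"
proof -
  have Qx: "Q *\<^sub>v x \<in> carrier_vec n" using Q(1) x by (rule mult_mat_vec_carrier)
  have "x = transpose_mat Q *\<^sub>v (Q *\<^sub>v x)"
    using assoc_mult_mat_vec[of "transpose_mat Q" n n Q n x] Q x by simp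
  then have "x \<bullet> x = (transpose_mat Q *\<^sub>v (Q *\<^sub>v x)) \<bullet> x" by simp
  also have "\<dots> = (Q *\<^sub>v x) \<bullet> (Q *\<^sub>v x)"
    by (rule transpose_vec_mult_scalar[OF Q(1) x Qx])
  also have "\<dots> = (\<Sum>i<n. ((Q *\<^sub>v x) $ i)\<^sup>2)"
    using Q(1) by (auto simp: scalar_prod_def lessThan_atLeast0 power2_eq_square intro!: sum.cong)
  finally show ?thesis .
qed

lemma quadratic_form_mat_diag:
  fixes x :: "real vec"
  assumes x: "x \<in> carrier_vec n"
  shows "x \<bullet> (mat_diag n f *\<^sub>v x) = (\<Sum>i<n. f i * (x $ i)\<^sup>2)"
proof -
  have "(mat_diag n f *\<^sub>v x) $ i = f i * x $ i" if "i < n" for i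
  proof -
    have "(mat_diag n f *\<^sub>v x) $ i = (\<Sum>k<n. (if i = k then f k else 0) * x $ k)"
      using that x by (simp add: mat_diag_def scalar_prod_def lessThan_atLeast0)
    also have "\<dots> = (\<Sum>k<n. if i = k then f k * x $ k else 0)"
      by (intro sum.cong) auto
    finally show ?thesis using that by simp
  qed
  moreover have "dim_vec (mat_diag n f *\<^sub>v x) = n" by (simp add: mat_diag_def)
  ultimately show ?thesis
    by (simp add: scalar_prod_def lessThan_atLeast0 power2_eq_square mult_ac)
qed

text \<open>Moving \<open>transpose_mat Q\<close> across the scalar product leaves a diagonal form
  in the coordinates \<open>Q *\<^sub>v x\<close>; when \<open>Q\<close> is orthogonal, its rows are
  the eigenvectors.\<close>

lemma quadratic_form_diagonalization:
  fixes Q :: "real mat"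
  assumes Q: "Q \<in> carrier_mat n n" and x: "x \<in> carrier_vec n"
  shows "x \<bullet> ((transpose_mat Q * mat_diag n f * Q) *\<^sub>v x) = (\<Sum>i<n. f i * ((Q *\<^sub>v x) $ i)\<^sup>2)"
proof -
  let ?y = "mat_diag n f *\<^sub>v (Q *\<^sub>v x)"
  have Qx: "Q *\<^sub>v x \<in> carrier_vec n" using Q x by (rule mult_mat_vec_carrier)
  have y: "?y \<in> carrier_vec n" using mat_diag_dim Qx by (rule mult_mat_vec_carrier)
  have QD: "transpose_mat Q * mat_diag n f \<in> carrier_mat n n"
    by (rule mult_carrier_mat[of _ n n]) (use Q in auto)
  have "(transpose_mat Q * mat_diag n f * Q) *\<^sub>v x = transpose_mat Q *\<^sub>v ?y"
    using assoc_mult_mat_vec[OF QD Q x]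
      assoc_mult_mat_vec[of "transpose_mat Q" n n "mat_diag n f" n "Q *\<^sub>v x"] Q Qx by simp
  moreover have "x \<bullet> (transpose_mat Q *\<^sub>v ?y) = (transpose_mat Q *\<^sub>v ?y) \<bullet> x"
    by (rule comm_scalar_prod[OF x]) (rule mult_mat_vec_carrier[OF _ y], use Q in simp)
  moreover have "\<dots> = ?y \<bullet> (Q *\<^sub>v x)" by (rule transpose_vec_mult_scalar[OF Q x y])
  moreover have "\<dots> = (Q *\<^sub>v x) \<bullet> ?y" by (rule comm_scalar_prod[OF y Qx])
  ultimately show ?thesis using quadratic_form_mat_diag[OF Qx] by simp
qed

section \<open>Weyl monotonicity of ordered eigenvalues\<close>

text \<open>Every product in the Leibniz formula contains a factor from row
  \<open>j\<close>.\<close>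

lemma det_zero_row:
  assumes M: "M \<in> carrier_mat n n" and j: "j < n" and 0: "\<And>k. k < n \<Longrightarrow> M $$ (j, k) = 0"
  shows "det M = 0"
proof -
  have "(\<Prod>i = 0..<n. M $$ (i, p i)) = 0" if "p permutes {0..<n}" for p
  proof (rule prod_zero)
    have "p j < n" using that j by (metis atLeastLessThan_iff permutes_in_image zero_le)
    then show "\<exists>i\<in>{0..<n}. M $$ (i, p i) = 0"
      using j 0[of "p j"] by (intro bexI[of _ j]) auto
  qed simp
  then show ?thesis by (simp add: det_def'[OF M])
qed

(* The first j + 1 eigenvectors of A span a space of dimension j + 1, which meets the
   complement of the first j eigenvectors of B; comparing both forms on a common vector x
   compares the j-th eigenvalues. The vector x is found in the kernel of a singular square
   matrix that encodes both membership conditions. *)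
lemma nth_eigenvalue_le:
  fixes A B :: "real mat"
  assumes A: "A \<in> carrier_mat n n" "transpose_mat A = A"
      "char_poly A = (\<Prod>e\<leftarrow>as. [:- e, 1:])" "sorted_wrt (\<ge>) as"
    and B: "B \<in> carrier_mat n n" "transpose_mat B = B"
      "char_poly B = (\<Prod>e\<leftarrow>bs. [:- e, 1:])" "sorted_wrt (\<ge>) bs"
    and le: "\<And>x. x \<in> carrier_vec n \<Longrightarrow> x \<bullet> (A *\<^sub>v x) + c * (x \<bullet> x) \<le> x \<bullet> (B *\<^sub>v x)"
    and j: "j < n"
  shows "as ! j + c \<le> bs ! j"
proof -
  have len: "length as = n" "length bs = n"
    using degree_monic_char_poly[OF A(1)] degree_monic_char_poly[OF B(1)]
      degree_linear_factors[of uminus as] degree_linear_factors[of uminus bs] A(3) B(3) by auto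
  obtain P where P: "P \<in> carrier_mat n n" "transpose_mat P * P = 1\<^sub>m n"
    "A = transpose_mat P * mat_diag n ((!) as) * P"
    using symmetric_diagonalization[OF A(1-3)] by blast
  obtain Q where Q: "Q \<in> carrier_mat n n" "transpose_mat Q * Q = 1\<^sub>m n"
    "B = transpose_mat Q * mat_diag n ((!) bs) * Q"
    using symmetric_diagonalization[OF B(1-3)] by blast
  have Pt: "transpose_mat P \<in> carrier_mat n n" using P by simp
  have PPt: "P * transpose_mat P = 1\<^sub>m n" by (rule mat_mult_left_right_inverse[OF Pt P(1,2)])
  have QPt: "Q * transpose_mat P \<in> carrier_mat n n" by (rule mult_carrier_mat[OF Q(1) Pt])
  \<comment> \<open>In the coordinates \<open>y = P x\<close>, the rows above \<open>j\<close>
    demand that the first \<open>j\<close> coordinates of \<open>Q x\<close> vanish, and the rows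
    below \<open>j\<close> demand \<open>y $ i = 0\<close> for \<open>i > j\<close>. The zero row
    \<open>j\<close> makes the matrix singular.\<close>
  define M where "M = mat n n (\<lambda>(i, k). if i < j then (Q * transpose_mat P) $$ (i, k)
    else if i \<noteq> j \<and> i = k then 1 else 0)"
  have M: "M \<in> carrier_mat n n" by (simp add: M_def)
  have "det M = 0" by (rule det_zero_row[OF M j]) (use j in \<open>simp add: M_def\<close>)
  then obtain y where y: "y \<in> carrier_vec n" "y \<noteq> 0\<^sub>v n" "M *\<^sub>v y = 0\<^sub>v n"
    using det_0_iff_vec_prod_zero[OF M] by blast
  define x where "x = transpose_mat P *\<^sub>v y"
  have x: "x \<in> carrier_vec n" unfolding x_def by (rule mult_mat_vec_carrier[OF Pt y(1)])
  have Px: "P *\<^sub>v x = y"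
    unfolding x_def using assoc_mult_mat_vec[OF P(1) Pt y(1)] PPt y(1) by simp
  have Qx: "Q *\<^sub>v x = (Q * transpose_mat P) *\<^sub>v y"
    unfolding x_def using assoc_mult_mat_vec[OF Q(1) Pt y(1)] by simp
  have My: "row M i \<bullet> y = 0" if "i < n" for i
    using that y(3) M by (metis carrier_matD(1) index_mult_mat_vec index_zero_vec(1))
  have y0: "y $ k = 0" if k: "k < n" "j < k" for k
  proof -
    have "row M k = unit_vec n k"
      using k by (intro eq_vecI) (auto simp: M_def unit_vec_def)
    then show ?thesis using My[OF k(1)] y(1) k by simp
  qed
  have z0: "(Q *\<^sub>v x) $ k = 0" if k: "k < j" for k
  proof -
    have "row M k = row (Q * transpose_mat P) k"
      using k j Q(1) P(1) by (intro eq_vecI) (auto simp: M_def)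
    then show ?thesis using My[of k] k j Q(1) unfolding Qx by simp
  qed
  have xx: "x \<bullet> x = (\<Sum>i<n. (y $ i)\<^sup>2)"
    using orthogonal_preserves_scalar_prod[OF P(1,2) x] Px by simp
  have "\<exists>i<n. y $ i \<noteq> 0" using y by (metis carrier_vecD eq_vecI index_zero_vec)
  then have pos: "x \<bullet> x > 0" unfolding xx by (auto intro!: sum_pos2)
  \<comment> \<open>Only coordinates \<open>i \<le> j\<close> of \<open>P x\<close> survive, and
    there \<open>as ! i\<close> is at least \<open>as ! j\<close>.\<close>
  have "as ! j * (x \<bullet> x) = (\<Sum>i<n. as ! j * (y $ i)\<^sup>2)" by (simp add: xx sum_distrib_left)
  also have "\<dots> \<le> (\<Sum>i<n. as ! i * (y $ i)\<^sup>2)"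
  proof (rule sum_mono)
    fix i assume i: "i \<in> {..<n}"
    consider "j < i" | "i = j" | "i < j" by linarith
    then show "as ! j * (y $ i)\<^sup>2 \<le> as ! i * (y $ i)\<^sup>2"
    proof cases
      case 3
      then have "as ! j \<le> as ! i" using A(4) j len by (auto simp: sorted_wrt_iff_nth_less)
      then show ?thesis by (simp add: mult_right_mono)
    qed (use i y0 in auto)
  qed
  also have "\<dots> = x \<bullet> (A *\<^sub>v x)"
    using quadratic_form_diagonalization[OF P(1) x, of "(!) as"] by (simp add: Px flip: P(3))
  finally have 1: "as ! j * (x \<bullet> x) \<le> x \<bullet> (A *\<^sub>v x)" .
  \<comment> \<open>Only coordinates \<open>i \<ge> j\<close> of \<open>Q x\<close> survive, and
    there \<open>bs ! i\<close> is at most \<open>bs ! j\<close>.\<close>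
  have "x \<bullet> (B *\<^sub>v x) = (\<Sum>i<n. bs ! i * ((Q *\<^sub>v x) $ i)\<^sup>2)"
    using quadratic_form_diagonalization[OF Q(1) x, of "(!) bs"] by (simp flip: Q(3))
  also have "\<dots> \<le> (\<Sum>i<n. bs ! j * ((Q *\<^sub>v x) $ i)\<^sup>2)"
  proof (rule sum_mono)
    fix i assume i: "i \<in> {..<n}"
    consider "i < j" | "i = j" | "j < i" by linarith
    then show "bs ! i * ((Q *\<^sub>v x) $ i)\<^sup>2 \<le> bs ! j * ((Q *\<^sub>v x) $ i)\<^sup>2"
    proof cases
      case 3
      then have "bs ! i \<le> bs ! j" using B(4) i len by (auto simp: sorted_wrt_iff_nth_less)
      then show ?thesis by (simp add: mult_right_mono)
    qed (use z0 in auto)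
  qed
  also have "\<dots> = bs ! j * (x \<bullet> x)"
    using orthogonal_preserves_scalar_prod[OF Q(1,2) x] by (simp add: sum_distrib_left)
  finally have "as ! j * (x \<bullet> x) + c * (x \<bullet> x) \<le> bs ! j * (x \<bullet> x)"
    using 1 le[OF x] by linarith
  then have "(as ! j + c) * (x \<bullet> x) \<le> bs ! j * (x \<bullet> x)" by (simp add: distrib_right)
  then show ?thesis using pos by (rule mult_right_le_imp_le)
qed

text \<open>Links \<open>eigenvalue_desc\<close> to the lists of linear factors used above. Because
  the polynomial splits, \<open>proots\<close> returns all factors as a multiset, and sorting does
  not change their product.\<close>

lemma eigenvalue_desc_list:
  fixes A :: "real mat"
  assumes "A \<in> carrier_mat n n" "transpose_mat A = A"
  defines "es \<equiv> rev (sorted_list_of_multiset (proots (char_poly A)))"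
  shows "char_poly A = (\<Prod>e\<leftarrow>es. [:- e, 1:])" and "sorted_wrt (\<ge>) es"
proof -
  obtain fs where fs: "char_poly A = (\<Prod>e\<leftarrow>fs. [:- e, 1:])"
    using symmetric_char_poly_splits[OF assms(1,2)] by blast
  have "proots (\<Prod>e\<leftarrow>fs. [:- e, 1:]) = mset fs"
  proof (induction fs)
    case (Cons e fs)
    have "(\<Prod>e\<leftarrow>fs. [:- e, 1:]) \<noteq> 0" by (auto simp: prod_list_zero_iff)
    then show ?case using Cons by (simp add: proots_mult del: mult_pCons_left)
  qed simp
  then have "mset es = mset fs" by (simp add: es_def fs)
  then show "char_poly A = (\<Prod>e\<leftarrow>es. [:- e, 1:])"
    unfolding fs by (metis mset_map prod_mset_prod_list)
  show "sorted_wrt (\<ge>) es" by (simp add: es_def sorted_wrt_rev)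
qed

text \<open>The preceding comparison at list position \<open>j - 1\<close>, since
  \<open>eigenvalue_desc\<close> counts from 1.\<close>

lemma eigenvalue_desc_mono:
  assumes "A \<in> carrier_mat n n" "transpose_mat A = A" "B \<in> carrier_mat n n" "transpose_mat B = B"
    and "\<And>x. x \<in> carrier_vec n \<Longrightarrow> x \<bullet> (A *\<^sub>v x) + c * (x \<bullet> x) \<le> x \<bullet> (B *\<^sub>v x)"
    and "1 \<le> j" "j \<le> n"
  shows "eigenvalue_desc A j + c \<le> eigenvalue_desc B j"
  unfolding eigenvalue_desc_def
  by (rule nth_eigenvalue_le[OF assms(1,2) eigenvalue_desc_list[OF assms(1,2)]
        assms(3,4) eigenvalue_desc_list[OF assms(3,4)] assms(5)]) (use assms in auto)

text \<open>The diagonal summand adds a weighted sum of the \<open>(x $ i)\<^sup>2\<close> to the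
  quadratic form, which lies between \<open>l * (x \<bullet> x)\<close> and
  \<open>u * (x \<bullet> x)\<close>.\<close>

lemma eigenvalue_desc_add_mat_diag:
  assumes A: "A \<in> carrier_mat n n" "transpose_mat A = A"
    and d: "\<And>k. k < n \<Longrightarrow> l \<le> d k \<and> d k \<le> u"
    and j: "1 \<le> j" "j \<le> n"
  shows "eigenvalue_desc A j + l \<le> eigenvalue_desc (A + mat_diag n d) j"
    and "eigenvalue_desc (A + mat_diag n d) j \<le> eigenvalue_desc A j + u"
proof -
  let ?B = "A + mat_diag n d"
  have B: "?B \<in> carrier_mat n n" by simp
  have symB: "transpose_mat ?B = ?B"
    using A(1) by (subst transpose_add[of _ n n]) (auto simp: A(2) mat_diag_def intro!: eq_matI)
  have form: "x \<bullet> (?B *\<^sub>v x) = x \<bullet> (A *\<^sub>v x) + (\<Sum>i<n. d i * (x $ i)\<^sup>2)"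
    if x: "x \<in> carrier_vec n" for x
  proof -
    have Ax: "A *\<^sub>v x \<in> carrier_vec n" using A(1) x by (rule mult_mat_vec_carrier)
    have Dx: "mat_diag n d *\<^sub>v x \<in> carrier_vec n" using mat_diag_dim x by (rule mult_mat_vec_carrier)
    have "?B *\<^sub>v x = A *\<^sub>v x + mat_diag n d *\<^sub>v x"
      by (rule add_mult_distrib_mat_vec[OF A(1) _ x]) simp
    then show ?thesis
      using scalar_prod_add_distrib[OF x Ax Dx] quadratic_form_mat_diag[OF x] by simp
  qed
  have xx: "x \<bullet> x = (\<Sum>i<n. (x $ i)\<^sup>2)" if "x \<in> carrier_vec n" for x :: "real vec"
    using that by (simp add: scalar_prod_def lessThan_atLeast0 power2_eq_square)
  show "eigenvalue_desc A j + l \<le> eigenvalue_desc ?B j"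
  proof (rule eigenvalue_desc_mono[OF A B symB _ j])
    fix x :: "real vec" assume x: "x \<in> carrier_vec n"
    have "l * (x \<bullet> x) \<le> (\<Sum>i<n. d i * (x $ i)\<^sup>2)"
      unfolding xx[OF x] sum_distrib_left using d by (intro sum_mono mult_right_mono) auto
    then show "x \<bullet> (A *\<^sub>v x) + l * (x \<bullet> x) \<le> x \<bullet> (?B *\<^sub>v x)" using form[OF x] by simp
  qed
  \<comment> \<open>The upper bound is monotonicity with the two matrices exchanged and shift
    \<open>- u\<close>.\<close>
  have "eigenvalue_desc ?B j + - u \<le> eigenvalue_desc A j"
  proof (rule eigenvalue_desc_mono[OF B symB A _ j])
    fix x :: "real vec" assume x: "x \<in> carrier_vec n"
    have "(\<Sum>i<n. d i * (x $ i)\<^sup>2) \<le> u * (x \<bullet> x)"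
      unfolding xx[OF x] sum_distrib_left using d by (intro sum_mono mult_right_mono) auto
    then show "x \<bullet> (?B *\<^sub>v x) + - u * (x \<bullet> x) \<le> x \<bullet> (A *\<^sub>v x)" using form[OF x] by simp
  qed
  then show "eigenvalue_desc ?B j \<le> eigenvalue_desc A j + u" by simp
qed

section \<open>The ordered divisors of the radical of \<open>n\<close>\<close>

lemma divisor_order_snoc:
  "divisor_order (ps @ [p]) = divisor_order ps @ map (\<lambda>d. d * p) (divisor_order ps)"
  by (simp add: divisor_order_def)

lemma length_divisor_order: "length (divisor_order ps) = 2 ^ length ps"
  by (induction ps rule: rev_induct) (simp_all add: divisor_order_snoc, simp add: divisor_order_def)

lemma divisor_order_dvd: "d \<in> set (divisor_order ps) \<Longrightarrow> d dvd prod_list ps"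
  by (induction ps arbitrary: d rule: rev_induct)
    (auto simp: divisor_order_snoc, simp add: divisor_order_def)

text \<open>The bound on \<open>k\<close> leaves out exactly the last entry, the full product. An
  entry of the first half divides the product of the earlier primes, which is smaller because
  \<open>p \<ge> 2\<close>. In the second half the factor \<open>p\<close> cancels and the shifted
  index again avoids the last position.\<close>

lemma divisor_order_less:
  assumes "\<forall>p\<in>set ps. 2 \<le> p" "k < 2 ^ length ps - 1"
  shows "divisor_order ps ! k < prod_list ps"
  using assms
proof (induction ps arbitrary: k rule: rev_induct)
  case (snoc p ps)
  let ?l = "2 ^ length ps :: nat"
  have pos: "0 < prod_list ps"
    using snoc.prems(1) by (intro Nat.gr0I) (auto simp: prod_list_zero_iff)
  show ?case
  proof (cases "k < ?l")
    case True
    then have "divisor_order ps ! k dvd prod_list ps"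
      by (intro divisor_order_dvd nth_mem) (simp add: length_divisor_order)
    then have "divisor_order ps ! k \<le> prod_list ps" using pos by (rule dvd_imp_le)
    moreover have "prod_list ps < prod_list ps * p" using pos snoc.prems(1) by simp
    ultimately have "divisor_order ps ! k < prod_list ps * p" by (rule order.strict_trans1)
    then show ?thesis
      using True by (simp add: divisor_order_snoc nth_append length_divisor_order)
  next
    case False
    then have "divisor_order ps ! (k - ?l) < prod_list ps"
      using snoc by (intro snoc.IH) auto
    then show ?thesis
      using False snoc.prems
      by (simp add: divisor_order_snoc nth_append length_divisor_order)
  qed
qed simp

text \<open>The prime factors taken once each form a submultiset of the prime factorization.\<close>

lemma n0_dvd: "n0 n dvd n"
proof (cases "n = 0")
  case False
  have "n0 n = prod_mset (mset_set (prime_factors n))"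
    by (simp add: n0_def prod_unfold_prod_mset)
  also have "\<dots> dvd prod_mset (prime_factorization n)"
    by (intro prod_mset_subset_imp_dvd mset_set_set_mset_msubset)
  finally show ?thesis using False by (simp add: prod_mset_prime_factorization_nat)
qed simp

text \<open>Here \<open>k\<close> is a matrix position counted from 0. The last position is
  excluded, as its divisor is \<open>n0 n\<close> itself and \<open>L_Q\<close> prescribes its
  diagonal entry directly.\<close>

lemma dvs_proper_divisor:
  assumes "k < 2 ^ card (prime_factors n) - 1"
  shows "dvs n (k + 1) dvd n0 n" and "dvs n (k + 1) < n0 n"
proof -
  let ?ps = "sorted_list_of_set (prime_factors n)"
  have n0: "n0 n = prod_list ?ps"
    using prod.distinct_set_conv_list[of ?ps id] by (simp add: n0_def)
  have len: "length ?ps = card (prime_factors n)" by simp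
  have "divisor_order ?ps ! k \<in> set (divisor_order ?ps)"
    using assms by (intro nth_mem) (simp add: length_divisor_order)
  then show "dvs n (k + 1) dvd n0 n" by (simp add: n0 dvs_def divisor_order_dvd)
  have "divisor_order ?ps ! k < prod_list ?ps"
    using assms by (intro divisor_order_less) (auto dest: in_prime_factors_imp_prime prime_ge_2_nat)
  then show "dvs n (k + 1) < n0 n" by (simp add: n0 dvs_def)
qed

section \<open>Degrees in the generating graph\<close>

text \<open>The neighbours of a vertex in the class of \<open>d\<close> are the residues coprime to
  \<open>d\<close>, without the vertex itself when \<open>d = 1\<close>. Since \<open>d\<close>
  divides \<open>n\<close>, they include all units if \<open>d\<close> is not 1.\<close>

lemma class_degree_bounds:
  assumes n: "n \<ge> 2" and d: "d dvd n0 n" "d < n0 n"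
  shows "totient n \<le> class_degree n d" and "class_degree n d \<le> n"
proof -
  let ?S = "{b \<in> {0..<int n}. coprime b (int d)}"
  have dn: "d dvd n" using d n0_dvd dvd_trans by blast
  have "n0 n \<le> n" using n0_dvd n by (intro dvd_imp_le) auto
  \<comment> \<open>From \<open>d < n0 n \<le> n\<close>, the number \<open>d\<close> is a residue
    and represents its own class; this makes \<open>class_degree\<close> meaningful.\<close>
  then have "int d \<in> dclass n d"
    using d n by (simp add: dclass_def carrier_integer_mod_group gcd_nat.absorb1)
  then have deg: "class_degree n d = card ?S - (if d = 1 then 1 else 0)"
    using class_degree_eq[OF n] gen_degree_dclass[OF n] by simp
  have "card ?S \<le> card {0..<int n}" by (intro card_mono) auto
  then show "class_degree n d \<le> n" by (simp add: deg)
  show "totient n \<le> class_degree n d"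
  proof (cases "d = 1")
    \<comment> \<open>A unit is adjacent to all \<open>n - 1\<close> other vertices, and
      \<open>totient n < n\<close>.\<close>
    case True
    then have "?S = {0..<int n}" by auto
    then show ?thesis using True deg totient_less[of n] n by simp
  next
    case False
    \<comment> \<open>\<open>totatives n\<close> is taken from 1 to \<open>n\<close>; as
      \<open>n \<ge> 2\<close> is not coprime to itself, all totatives are residues below
      \<open>n\<close>.\<close>
    have "k < n" if "k \<in> totatives n" for k
      using that n by (cases "k = n") (auto simp: totatives_def)
    then have "int ` totatives n \<subseteq> ?S"
      using dn by (auto simp: totatives_def intro: coprime_divisors[OF dvd_refl])
    moreover have "finite ?S" by (rule finite_subset[of _ "{0..<int n}"]) auto
    ultimately have "card (int ` totatives n) \<le> card ?S" by (intro card_mono)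
    then show ?thesis using False by (simp add: deg totient_def card_image)
  qed
qed

section \<open>The diagonal difference of the two matrices\<close>

lemma rho_commute: "rho n i j = rho n j i"
  by (simp add: rho_def gcd.commute mult.commute)

theorem theorem5p0p4:
  fixes n r j :: nat
  assumes "n \<ge> 2" and "r = card (prime_factors n)"
    and "1 \<le> j" and "j \<le> 2 ^ r"
  shows "eigenvalue_desc (- Q_tilde n) j + real (totient n) \<le> eigenvalue_desc (L_Q n) j \<and>
         eigenvalue_desc (L_Q n) j \<le> eigenvalue_desc (- Q_tilde n) j + real n"
proof -
  define m :: nat where "m = 2 ^ r"
  \<comment> \<open>The diagonal of \<open>L_Q n + Q_tilde n\<close>: at position 0 the two entries
    \<open>n - totient n\<close> and \<open>totient n\<close> add up to \<open>n\<close>, and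
    elsewhere \<open>Q_tilde n\<close> contributes 0.\<close>
  define d where "d k = (if k = 0 then real n else if k = m - 1 then real (totient n)
    else real (class_degree n (dvs n (k + 1))))" for k
  have Q: "- Q_tilde n \<in> carrier_mat m m"
    using assms(2) by (simp add: Q_tilde_def m_def Let_def)
  have sym: "transpose_mat (- Q_tilde n) = - Q_tilde n"
    using assms(2) by (intro eq_matI) (auto simp: Q_tilde_def Let_def rho_commute)
  \<comment> \<open>Off the diagonal both \<open>L_Q n\<close> and \<open>- Q_tilde n\<close> have
    the entries \<open>- rho\<close>, so only the diagonals differ.\<close>
  have L: "L_Q n = - Q_tilde n + mat_diag m d"
    using assms(2)
    by (intro eq_matI) (auto simp: L_Q_def Q_tilde_def mat_diag_def m_def d_def Let_def)
  have d: "real (totient n) \<le> d k \<and> d k \<le> real n" if "k < m" for k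
  proof -
    consider "k = 0" | "k = m - 1" | "k \<noteq> 0" "k < m - 1" using \<open>k < m\<close> by linarith
    then show ?thesis
    proof cases
      case 3
      then have "k < 2 ^ card (prime_factors n) - 1" using assms(2) by (simp add: m_def)
      then show ?thesis
        using 3 class_degree_bounds[OF assms(1) dvs_proper_divisor] by (simp add: d_def)
    qed (auto simp: d_def totient_le)
  qed
  show ?thesis
    unfolding L using eigenvalue_desc_add_mat_diag[OF Q sym d assms(3)] assms(4)
    by (simp add: m_def)
qed

end
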